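(* Let $(\Omega,\mathcal{G},\mathbb{P})$ be a probability space and let $\xi=(\xi_n)_{n\in\mathbb{N}}$ be a sequence of independent random elements on it, with $\xi_n$ valued in a countable set $E_n$ for each $n\in\mathbb{N}$. Consider the following statements. (i) For all $n\in\mathbb{N}$ and $e\in E_n$, $\mathbb{P}(\xi_n=e)>0$. (ii) For every $\Omega^*\in\sigma(\xi)$ with $\mathbb{P}(\Omega^* )=1$ there exists $\Omega^{**}\in\limsup_{n\to\infty}\sigma(\xi_n)$ with $\mathbb{P}(\Omega^{**})=1$ and $\Omega^{**}\subset\Omega^*$. (iii) For every $\Omega^*\in\sigma(\xi)$ with $\mathbb{P}(\Omega^* )=0$ there exists $\Omega^{**}\in\limsup_{n\to\infty}\sigma(\xi_n)$ with $\mathbb{P}(\Omega^{**})=0$ and $\Omega^{**}\supset\Omega^*$. Then (ii) and (iii) are equivalent, and they are implied by (i). If furthermore $\xi$ is sufficiently nice in the sense that for all $n\in\mathbb{N}$, for all $\{e,f\}\subset E_n$ with $e\neq f$ and $\mathbb{P}(\xi_n=e)=0$, and for all $\omega\in\Omega$ with $\xi_n(\omega)=f$, there exist an $\omega'\in\Omega$ and a $k\in\mathbb{N}$ such that $\xi_n(\omega')=e$ while $\xi_l(\omega)=\xi_l(\omega')$ for all $l\in\mathbb{N}$ with $l\geq k$, then the statements (i), (ii), (iii) are all equivalent.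
   Context: $\mathbb{N}=\{1,2,3,\ldots\}$. Each countable (finite or countably infinite) set $E_n$ is endowed with its power set $2^{E_n}$ as $\sigma$-field. $\sigma(\xi)$ is the $\sigma$-field on $\Omega$ generated by all the $\xi_n$, $n\in\mathbb{N}$. The tail $\sigma$-field is $$\limsup_{n\to\infty}\sigma(\xi_n):=\bigcap_{F\subset\mathbb{N}\text{ finite}}\ \bigvee_{i\in\mathbb{N}\backslash F}\sigma(\xi_i),$$ where $\bigvee$ denotes the $\sigma$-field generated by the union; equivalently it is $\bigcap_{n\in\mathbb{N}}\sigma(\xi_n,\xi_{n+1},\ldots)$. *)

theory Defs
  imports "HOL-Probability.Probability"
begin

definition sigma_of ::
  "'a measure \<Rightarrow> ('i \<Rightarrow> 'b set) \<Rightarrow> ('i \<Rightarrow> 'a \<Rightarrow> 'b) \<Rightarrow> 'i set \<Rightarrow> 'a set set"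
  where "sigma_of M E \<xi> I =
    sigma_sets (space M) (\<Union>i\<in>I. sets (vimage_algebra (space M) (\<xi> i) (count_space (E i))))"

definition tail_sigma ::
  "'a measure \<Rightarrow> ('i \<Rightarrow> 'b set) \<Rightarrow> ('i \<Rightarrow> 'a \<Rightarrow> 'b) \<Rightarrow> 'i set \<Rightarrow> 'a set set"
  where "tail_sigma M E \<xi> I = (\<Inter>F\<in>{F. finite F \<and> F \<subseteq> I}. sigma_of M E \<xi> (I - F))"

definition all_values_positive ::
  "'a measure \<Rightarrow> (nat \<Rightarrow> 'b set) \<Rightarrow> (nat \<Rightarrow> 'a \<Rightarrow> 'b) \<Rightarrow> bool"
  where "all_values_positive M E \<xi> \<longleftrightarrow>
    (\<forall>n\<ge>1. \<forall>e\<in>E n. measure M {\<omega>\<in>space M. \<xi> n \<omega> = e} > 0)"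

definition sure_events_shrink_to_tail ::
  "'a measure \<Rightarrow> (nat \<Rightarrow> 'b set) \<Rightarrow> (nat \<Rightarrow> 'a \<Rightarrow> 'b) \<Rightarrow> bool"
  where "sure_events_shrink_to_tail M E \<xi> \<longleftrightarrow>
    (\<forall>A \<in> sigma_of M E \<xi> {1..}. measure M A = 1 \<longrightarrow>
      (\<exists>B \<in> tail_sigma M E \<xi> {1..}. measure M B = 1 \<and> B \<subseteq> A))"

definition null_events_extend_to_tail ::
  "'a measure \<Rightarrow> (nat \<Rightarrow> 'b set) \<Rightarrow> (nat \<Rightarrow> 'a \<Rightarrow> 'b) \<Rightarrow> bool"
  where "null_events_extend_to_tail M E \<xi> \<longleftrightarrow>
    (\<forall>A \<in> sigma_of M E \<xi> {1..}. measure M A = 0 \<longrightarrow>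
      (\<exists>B \<in> tail_sigma M E \<xi> {1..}. measure M B = 0 \<and> A \<subseteq> B))"

definition sufficiently_nice ::
  "'a measure \<Rightarrow> (nat \<Rightarrow> 'b set) \<Rightarrow> (nat \<Rightarrow> 'a \<Rightarrow> 'b) \<Rightarrow> bool"
  where "sufficiently_nice M E \<xi> \<longleftrightarrow>
    (\<forall>n\<ge>1. \<forall>e\<in>E n. \<forall>f\<in>E n. e \<noteq> f \<longrightarrow> measure M {\<omega>\<in>space M. \<xi> n \<omega> = e} = 0 \<longrightarrow>
      (\<forall>\<omega>\<in>space M. \<xi> n \<omega> = f \<longrightarrow>
        (\<exists>\<omega>'\<in>space M. \<exists>k\<ge>1. \<xi> n \<omega>' = e \<and> (\<forall>l\<ge>k. \<xi> l \<omega> = \<xi> l \<omega>'))))"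

text \<open>For index set \<open>{1..}\<close> the tail \<open>\<sigma>\<close>-field agrees with the library's \<open>tail_events\<close>.\<close>

lemma tail_sigma_eq_tail_events:
  fixes M :: "'a measure" and E :: "nat \<Rightarrow> 'b set" and \<xi> :: "nat \<Rightarrow> 'a \<Rightarrow> 'b"
  assumes "prob_space M"
  shows "tail_sigma M E \<xi> {1..} = prob_space.tail_events M
    (\<lambda>n. sets (vimage_algebra (space M) (\<xi> n) (count_space (E n))))"
proof -
  interpret prob_space M by fact
  let ?A = "\<lambda>n. sets (vimage_algebra (space M) (\<xi> n) (count_space (E n)))"
  have mono: "sigma_of M E \<xi> I \<subseteq> sigma_of M E \<xi> J" if "I \<subseteq> J" for I J :: "nat set"
    using that unfolding sigma_of_def by (intro sigma_sets_mono' UN_mono) simp_all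
  have tail: "tail_events ?A = (\<Inter>n. sigma_of M E \<xi> {n..})"
    by (simp add: tail_events_def sigma_of_def)
  have le: "tail_sigma M E \<xi> {1..} \<subseteq> sigma_of M E \<xi> {n..}" for n
  proof -
    have "tail_sigma M E \<xi> {1..} \<subseteq> sigma_of M E \<xi> ({1..} - {1..<n})"
      unfolding tail_sigma_def by (intro INF_lower) auto
    also have "\<dots> \<subseteq> sigma_of M E \<xi> {n..}"
      by (intro mono) auto
    finally show ?thesis .
  qed
  have ge: "(\<Inter>n. sigma_of M E \<xi> {n..}) \<subseteq> sigma_of M E \<xi> ({1..} - F)" if "finite F" for F :: "nat set"
  proof -
    obtain m where m: "\<forall>x\<in>F. x \<le> m"
      using \<open>finite F\<close> by (auto simp: finite_nat_set_iff_bounded_le)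
    have "(\<Inter>n. sigma_of M E \<xi> {n..}) \<subseteq> sigma_of M E \<xi> {Suc m..}"
      by (intro INF_lower) auto
    also have "\<dots> \<subseteq> sigma_of M E \<xi> ({1..} - F)"
    proof (rule mono, rule subsetI)
      fix x assume "x \<in> {Suc m..}"
      then show "x \<in> {1..} - F"
        using m by auto
    qed
    finally show ?thesis .
  qed
  have "tail_sigma M E \<xi> {1..} \<subseteq> (\<Inter>n. sigma_of M E \<xi> {n..})"
    by (rule INF_greatest) (rule le)
  moreover have "(\<Inter>n. sigma_of M E \<xi> {n..}) \<subseteq> tail_sigma M E \<xi> {1..}"
    unfolding tail_sigma_def by (rule INF_greatest) (rule ge, simp)
  ultimately show ?thesis
    unfolding tail by (rule subset_antisym)
qed

end

theory Submission
  imports Defs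
begin

text \<open>
  The key is a single step: if every value of \<open>\<xi> m\<close> has positive probability, a null event of
  \<open>\<sigma>(\<xi>\<^sub>m, \<xi>\<^bsub>m+1\<^esub>, \<dots>)\<close> is contained in a null event of
  \<open>\<sigma>(\<xi>\<^bsub>m+1\<^esub>, \<dots>)\<close> (\<open>null_event_forget_index\<close>). Indeed such an event consists
  of the \<open>\<omega>\<close> with \<open>\<omega> \<in> B (\<xi> m \<omega>)\<close>, where every section \<open>B e\<close> belongs to
  \<open>\<sigma>(\<xi>\<^bsub>m+1\<^esub>, \<dots>)\<close> (\<open>sigma_of_insert_sections\<close>). By independence
  \<open>{\<xi> m = e} \<inter> B e\<close> has probability \<open>\<P>(\<xi> m = e) * \<P>(B e)\<close>, so positivity makes all sections
  null, and so is their countable union, which contains the event. Iterating the step gives an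
  increasing sequence of null events that depend on later and later coordinates; dropping initial
  members does not change its union, which is therefore a null tail event. This gives (iii) from
  (i), and (ii) is (iii) for complements.

  Conversely, whether \<open>\<omega>\<close> lies in a tail event is decided by the values \<open>\<xi> l \<omega>\<close> for
  large \<open>l\<close>. If \<open>\<xi> n = e\<close> had probability zero and were contained in a null tail event
  \<open>B\<close>, take \<open>\<omega>\<close> outside \<open>B\<close>. Niceness changes \<open>\<omega>\<close> in finitely many coordinates into an
  \<open>\<omega>'\<close> with \<open>\<xi> n \<omega>' = e\<close>, hence with \<open>\<omega>' \<in> B\<close>, although \<open>\<omega>\<close> and \<open>\<omega>'\<close> cannot be
  separated by a tail event.
\<close>

section \<open>The \<open>\<sigma>\<close>-fields generated by subfamilies, and the tail\<close>

text \<open>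
  The preimages under one \<open>\<xi> i\<close> are closed under intersection, so this generator is the one to
  which the extension of independence from generators to generated \<open>\<sigma>\<close>-fields applies.
\<close>

lemma sigma_of_eq_sigma_sets_preimages:
  assumes "\<And>i. i \<in> I \<Longrightarrow> \<xi> i \<in> space M \<rightarrow> E i"
  shows "sigma_of M E \<xi> I =
    sigma_sets (space M) (\<Union>i\<in>I. {\<xi> i -` S \<inter> space M | S. S \<in> sets (count_space (E i))})"
proof -
  have "sets (vimage_algebra (space M) (\<xi> i) (count_space (E i))) =
      {\<xi> i -` S \<inter> space M | S. S \<in> sets (count_space (E i))}" if "i \<in> I" for i
    using assms[OF that] by (subst sets_vimage_algebra2) auto
  then show ?thesis
    unfolding sigma_of_def by simp
qed

lemma sigma_algebra_sigma_of: "sigma_algebra (space M) (sigma_of M E \<xi> I)"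
  unfolding sigma_of_def
  using sets.sets_into_space
  by (intro sigma_algebra_sigma_sets UN_least) (fastforce simp: space_vimage_algebra)

lemma sigma_of_mono: "I \<subseteq> J \<Longrightarrow> sigma_of M E \<xi> I \<subseteq> sigma_of M E \<xi> J"
  unfolding sigma_of_def by (intro sigma_sets_mono' UN_mono) simp_all

lemma sigma_of_subset_sets:
  assumes "\<And>i. i \<in> I \<Longrightarrow> \<xi> i \<in> measurable M (count_space (E i))"
  shows "sigma_of M E \<xi> I \<subseteq> sets M"
proof -
  have "\<xi> i \<in> space M \<rightarrow> E i" if "i \<in> I" for i
    using measurable_space[OF assms[OF that]] by auto
  then show ?thesis
    using measurable_sets[OF assms]
    by (subst sigma_of_eq_sigma_sets_preimages) (auto intro!: sets.sigma_sets_subset)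
qed

lemma level_set_in_sigma_of:
  assumes "i \<in> I" "e \<in> E i"
  shows "{\<omega> \<in> space M. \<xi> i \<omega> = e} \<in> sigma_of M E \<xi> I"
proof -
  have "\<xi> i -` {e} \<inter> space M \<in> sets (vimage_algebra (space M) (\<xi> i) (count_space (E i)))"
    using assms by (intro in_vimage_algebra) simp
  moreover have "\<xi> i -` {e} \<inter> space M = {\<omega> \<in> space M. \<xi> i \<omega> = e}"
    by auto
  ultimately show ?thesis
    using assms unfolding sigma_of_def by auto
qed

text \<open>
  The events that do not separate \<open>\<omega>\<close> from \<open>\<omega>'\<close> form a \<open>\<sigma>\<close>-field, and it contains every
  preimage under a coordinate on which the two points agree.
\<close>

lemma sigma_of_not_separating:
  assumes "A \<in> sigma_of M E \<xi> I"
    and range: "\<And>i. i \<in> I \<Longrightarrow> \<xi> i \<in> space M \<rightarrow> E i"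
    and "\<omega> \<in> space M" "\<omega>' \<in> space M"
    and "\<And>i. i \<in> I \<Longrightarrow> \<xi> i \<omega> = \<xi> i \<omega>'"
  shows "\<omega> \<in> A \<longleftrightarrow> \<omega>' \<in> A"
  using assms(1) unfolding sigma_of_eq_sigma_sets_preimages[of I \<xi> M E, OF range, simplified]
proof (induction rule: sigma_sets.induct)
  case (Basic A)
  then show ?case
    using assms(3-5) by auto
qed (use assms(3-4) in auto)

lemma tail_sigma_iff:
  "B \<in> tail_sigma M E \<xi> {1..} \<longleftrightarrow> (\<forall>k. B \<in> sigma_of M E \<xi> {Suc k..})"
proof
  assume B: "B \<in> tail_sigma M E \<xi> {1..}"
  have "{1..} - {1..k} = {Suc k..}" for k :: nat
    by auto
  moreover have "B \<in> sigma_of M E \<xi> ({1..} - {1..k})" for k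
    using B unfolding tail_sigma_def by auto
  ultimately show "\<forall>k. B \<in> sigma_of M E \<xi> {Suc k..}"
    by metis
next
  assume B: "\<forall>k. B \<in> sigma_of M E \<xi> {Suc k..}"
  have "B \<in> sigma_of M E \<xi> ({1..} - F)" if "finite F" for F
  proof -
    have "{Suc (Max (insert 0 F))..} \<subseteq> {1..} - F"
    proof
      fix x assume "x \<in> {Suc (Max (insert 0 F))..}"
      then show "x \<in> {1..} - F"
        using Max_ge[of "insert 0 F" x] that by fastforce
    qed
    from sigma_of_mono[OF this] B show ?thesis
      by blast
  qed
  then show "B \<in> tail_sigma M E \<xi> {1..}"
    unfolding tail_sigma_def by auto
qed

lemma tail_sigma_compl:
  fixes \<xi> :: "nat \<Rightarrow> 'a \<Rightarrow> 'b"
  assumes "B \<in> tail_sigma M E \<xi> {1..}"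
  shows "space M - B \<in> tail_sigma M E \<xi> {1..}"
  using assms unfolding tail_sigma_iff sigma_of_def by (simp add: sigma_sets.Compl)

text \<open>
  Such a family \<open>B\<close> plays the role of the sections of a measurable subset of a product space,
  without passing to the law of \<open>\<xi>\<close>. The events that admit one form a \<open>\<sigma>\<close>-field, since complements and countable
  unions can be taken section by section.
\<close>

lemma sigma_of_insert_sections:
  assumes A: "A \<in> sigma_of M E \<xi> (insert m I)"
    and range: "\<And>i. i \<in> insert m I \<Longrightarrow> \<xi> i \<in> space M \<rightarrow> E i"
  obtains B where "\<And>e. B e \<in> sigma_of M E \<xi> I" and "A = {\<omega> \<in> space M. \<omega> \<in> B (\<xi> m \<omega>)}"
proof -
  interpret S: sigma_algebra "space M" "sigma_of M E \<xi> I"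
    by (rule sigma_algebra_sigma_of)
  have "\<exists>B. (\<forall>e. B e \<in> sigma_of M E \<xi> I) \<and> A = {\<omega> \<in> space M. \<omega> \<in> B (\<xi> m \<omega>)}"
    using A unfolding sigma_of_eq_sigma_sets_preimages[of "insert m I" \<xi> M E, OF range, simplified]
  proof (induction rule: sigma_sets.induct)
    case (Basic A)
    then obtain i S where i: "i \<in> insert m I" and S: "S \<subseteq> E i" "A = \<xi> i -` S \<inter> space M"
      by auto
    show ?case
    proof (cases "i = m")
      case True
      then show ?thesis
        using S by (intro exI[of _ "\<lambda>e. if e \<in> S then space M else {}"]) auto
    next
      case False
      then have "A \<in> sigma_of M E \<xi> I"
        using i S range by (subst sigma_of_eq_sigma_sets_preimages) auto
      then show ?thesis
        using S by (intro exI[of _ "\<lambda>_. A"]) auto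
    qed
  next
    case Empty
    then show ?case
      by (intro exI[of _ "\<lambda>_. {}"]) auto
  next
    case (Compl A)
    then obtain B where "\<And>e. B e \<in> sigma_of M E \<xi> I" "A = {\<omega> \<in> space M. \<omega> \<in> B (\<xi> m \<omega>)}"
      by auto
    then show ?case
      by (intro exI[of _ "\<lambda>e. space M - B e"]) auto
  next
    case (Union A)
    then obtain B where "\<And>j e. B j e \<in> sigma_of M E \<xi> I"
      and "\<And>j. A j = {\<omega> \<in> space M. \<omega> \<in> B j (\<xi> m \<omega>)}"
      by metis
    then show ?case
      by (intro exI[of _ "\<lambda>e. \<Union>j. B j e"]) auto
  qed
  then show ?thesis
    using that by blast
qed

section \<open>Enlarging null events to null tail events\<close>

context prob_space
begin

text \<open>
  Grouping the indices into the blocks \<open>{m}\<close> and \<open>I\<close> preserves independence, because the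
  preimages under each single variable are stable under intersection.
\<close>

lemma prob_level_set_Int_sigma_of:
  assumes indep: "indep_vars (\<lambda>i. count_space (E i)) \<xi> (insert m I)"
    and "m \<notin> I" "e \<in> E m" and B: "B \<in> sigma_of M E \<xi> I"
  shows "prob ({\<omega> \<in> space M. \<xi> m \<omega> = e} \<inter> B) = prob {\<omega> \<in> space M. \<xi> m \<omega> = e} * prob B"
proof -
  let ?G = "\<lambda>i. {\<xi> i -` S \<inter> space M | S. S \<in> sets (count_space (E i))}"
  let ?J = "\<lambda>b. if b then {m} else I"
  have range: "\<xi> i \<in> space M \<rightarrow> E i" if "i \<in> insert m I" for i
    using indep that measurable_space[of "\<xi> i" M "count_space (E i)"]
    unfolding indep_vars_def by auto
  have "indep_sets (\<lambda>b. sigma_sets (space M) (\<Union>i\<in>?J b. ?G i)) UNIV"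
  proof (rule indep_sets_collect_sigma)
    have "(\<Union>b. ?J b) = insert m I"
      by auto
    then show "indep_sets ?G (\<Union>b. ?J b)"
      using indep by (simp add: indep_vars_def2)
    show "disjoint_family_on ?J UNIV"
      using \<open>m \<notin> I\<close> by (auto simp: disjoint_family_on_def)
    show "Int_stable (?G i)" for i
    proof (rule Int_stableI)
      fix a b assume "a \<in> ?G i" "b \<in> ?G i"
      then obtain S T where "a = \<xi> i -` S \<inter> space M" "b = \<xi> i -` T \<inter> space M"
        "S \<subseteq> E i" "T \<subseteq> E i"
        by auto
      then show "a \<inter> b \<in> ?G i"
        by (auto intro!: exI[of _ "S \<inter> T"])
    qed
  qed
  moreover have "sigma_sets (space M) (\<Union>i\<in>?J b. ?G i) = sigma_of M E \<xi> (?J b)" for b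
    using range by (intro sigma_of_eq_sigma_sets_preimages[symmetric]) (auto split: if_splits)
  ultimately have "indep_sets (\<lambda>b. sigma_of M E \<xi> (?J b)) UNIV"
    by simp
  from indep_setsD[OF this, of UNIV "\<lambda>b. if b then {\<omega> \<in> space M. \<xi> m \<omega> = e} else B"]
  show ?thesis
    using B level_set_in_sigma_of[of m "{m}" e E M \<xi>] \<open>e \<in> E m\<close> by (simp add: UNIV_bool Int_commute mult.commute)
qed

text \<open>
  The forgotten index is replaced by a union over its possible values, so the new event holds at
  \<open>\<omega>\<close> as soon as the old one would hold for some value of \<open>\<xi> m\<close>. Positivity keeps this
  from creating mass: a section of positive probability would make the old event non-null.
\<close>

lemma null_event_forget_index:
  assumes indep: "indep_vars (\<lambda>i. count_space (E i)) \<xi> (insert m I)"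
    and "m \<notin> I" "countable (E m)"
    and pos: "\<And>e. e \<in> E m \<Longrightarrow> prob {\<omega> \<in> space M. \<xi> m \<omega> = e} > 0"
    and A: "A \<in> sigma_of M E \<xi> (insert m I)" and "prob A = 0"
  obtains B where "B \<in> sigma_of M E \<xi> I" "prob B = 0" "A \<subseteq> B"
proof -
  have meas: "\<xi> i \<in> measurable M (count_space (E i))" if "i \<in> insert m I" for i
    using indep that unfolding indep_vars_def by auto
  have range: "\<xi> i \<in> space M \<rightarrow> E i" if "i \<in> insert m I" for i
    using measurable_space[OF meas[OF that]] by auto
  interpret S: sigma_algebra "space M" "sigma_of M E \<xi> I"
    by (rule sigma_algebra_sigma_of)
  obtain C where C: "\<And>e. C e \<in> sigma_of M E \<xi> I"
    and A_eq: "A = {\<omega> \<in> space M. \<omega> \<in> C (\<xi> m \<omega>)}"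
    using sigma_of_insert_sections[OF A range] by blast
  have A_event: "A \<in> events" and sub: "sigma_of M E \<xi> I \<subseteq> events"
    using sigma_of_subset_sets[of "insert m I" \<xi> M E] sigma_of_subset_sets[of I \<xi> M E] meas A
    by auto
  have null: "prob (C e) = 0" if "e \<in> E m" for e
  proof -
    have "prob ({\<omega> \<in> space M. \<xi> m \<omega> = e} \<inter> C e) \<le> prob A"
      using A_event by (intro finite_measure_mono) (auto simp: A_eq)
    then have "prob {\<omega> \<in> space M. \<xi> m \<omega> = e} * prob (C e) = 0"
      using \<open>prob A = 0\<close> measure_nonneg[of M "{\<omega> \<in> space M. \<xi> m \<omega> = e} \<inter> C e"]
      unfolding prob_level_set_Int_sigma_of[OF indep \<open>m \<notin> I\<close> that C] by simp
    then show ?thesis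
      using pos[OF that] by simp
  qed
  show ?thesis
  proof
    show "(\<Union>e\<in>E m. C e) \<in> sigma_of M E \<xi> I"
      using C \<open>countable (E m)\<close> by (intro S.countable_UN'') auto
    have "(\<Union>e\<in>E m. C e) \<in> null_sets M"
      using C sub null \<open>countable (E m)\<close>
      by (intro null_sets_UN') (auto intro!: null_setsI simp: emeasure_eq_measure)
    then show "prob (\<Union>e\<in>E m. C e) = 0"
      by (simp add: measure_eq_0_null_sets)
    show "A \<subseteq> (\<Union>e\<in>E m. C e)"
      using range[of m] by (auto simp: A_eq)
  qed
qed

lemma positive_imp_null_events_extend:
  assumes countable: "\<And>n. n \<ge> 1 \<Longrightarrow> countable (E n)"
    and indep: "indep_vars (\<lambda>n. count_space (E n)) \<xi> {1..}"
    and pos: "all_values_positive M E \<xi>"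
  shows "null_events_extend_to_tail M E \<xi>"
  unfolding null_events_extend_to_tail_def
proof (intro ballI impI)
  fix A assume A: "A \<in> sigma_of M E \<xi> {1..}" "prob A = 0"
  define Q where "Q k B \<longleftrightarrow> B \<in> sigma_of M E \<xi> {Suc k..} \<and> prob B = 0" for k B
  have step: "\<exists>B'. Q (Suc k) B' \<and> B \<subseteq> B'" if "Q k B" for k B
  proof -
    have eq: "insert (Suc k) {Suc (Suc k)..} = {Suc k..}"
      by auto
    have "indep_vars (\<lambda>n. count_space (E n)) \<xi> (insert (Suc k) {Suc (Suc k)..})"
      by (rule indep_vars_subset[OF indep]) auto
    then obtain B' where "B' \<in> sigma_of M E \<xi> {Suc (Suc k)..}" "prob B' = 0" "B \<subseteq> B'"
    proof (rule null_event_forget_index)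
      show "countable (E (Suc k))"
        by (rule countable) simp
      show "prob {\<omega> \<in> space M. \<xi> (Suc k) \<omega> = e} > 0" if "e \<in> E (Suc k)" for e
        using pos that unfolding all_values_positive_def by simp
      show "B \<in> sigma_of M E \<xi> (insert (Suc k) {Suc (Suc k)..})" "prob B = 0"
        using \<open>Q k B\<close> unfolding Q_def eq by simp_all
    qed simp
    then show ?thesis
      unfolding Q_def by blast
  qed
  \<comment> \<open>The clause for \<open>k = 0\<close> makes the chain start at \<open>A\<close>.\<close>
  have "\<exists>B. \<forall>k. (Q k (B k) \<and> (k = 0 \<longrightarrow> B k = A)) \<and> B k \<subseteq> B (Suc k)"
  proof (rule dependent_nat_choice)
    show "\<exists>B. Q 0 B \<and> (0 = (0::nat) \<longrightarrow> B = A)"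
      using A by (auto simp: Q_def)
    show "\<exists>B'. (Q (Suc k) B' \<and> (Suc k = 0 \<longrightarrow> B' = A)) \<and> B \<subseteq> B'"
      if "Q k B \<and> (k = 0 \<longrightarrow> B = A)" for B k
      using step that by auto
  qed
  then obtain B where B: "\<And>k. Q k (B k)" "B 0 = A" "\<And>k. B k \<subseteq> B (Suc k)"
    by metis
  have mono: "mono B"
    using B(3) by (simp add: mono_iff_le_Suc)
  have "(\<Union>j. B j) \<in> sigma_of M E \<xi> {Suc k..}" for k
  proof -
    interpret S: sigma_algebra "space M" "sigma_of M E \<xi> {Suc k..}"
      by (rule sigma_algebra_sigma_of)
    have "B (j + k) \<in> sigma_of M E \<xi> {Suc k..}" for j
      using B(1)[of "j + k"] sigma_of_mono[of "{Suc (j + k)..}" "{Suc k..}" M E \<xi>]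
      unfolding Q_def by auto
    moreover have "(\<Union>j. B j) = (\<Union>j. B (j + k))"
      using mono by (auto dest: monoD[OF _ le_add1, of B])
    ultimately show ?thesis
      by auto
  qed
  then have tail: "(\<Union>j. B j) \<in> tail_sigma M E \<xi> {1..}"
    unfolding tail_sigma_iff by blast
  have "\<xi> n \<in> measurable M (count_space (E n))" if "n \<ge> 1" for n
    using indep that unfolding indep_vars_def by auto
  then have "sigma_of M E \<xi> {Suc k..} \<subseteq> events" for k
    by (intro sigma_of_subset_sets) auto
  then have "(\<Union>j. B j) \<in> null_sets M"
    using B(1) unfolding Q_def
    by (intro null_sets_UN) (auto intro!: null_setsI simp: emeasure_eq_measure)
  then have "prob (\<Union>j. B j) = 0"
    by (simp add: measure_eq_0_null_sets)
  then show "\<exists>B\<in>tail_sigma M E \<xi> {1..}. prob B = 0 \<and> A \<subseteq> B"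
    using tail B(2) by blast
qed

section \<open>The equivalences\<close>

lemma sure_events_shrink_iff_null_events_extend:
  assumes meas: "\<And>n. n \<ge> 1 \<Longrightarrow> \<xi> n \<in> measurable M (count_space (E n))"
  shows "sure_events_shrink_to_tail M E \<xi> \<longleftrightarrow> null_events_extend_to_tail M E \<xi>"
proof -
  interpret S: sigma_algebra "space M" "sigma_of M E \<xi> {1..}"
    by (rule sigma_algebra_sigma_of)
  have event: "A \<in> events" if "A \<in> sigma_of M E \<xi> {1..}" for A
    using sigma_of_subset_sets[of "{1..}" \<xi> M E] meas that by auto
  have tail_event: "B \<in> events" if "B \<in> tail_sigma M E \<xi> {1..}" for B
    using that event[of B] unfolding tail_sigma_iff by (metis One_nat_def)
  show ?thesis
  proof
    assume sure: "sure_events_shrink_to_tail M E \<xi>"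
    show "null_events_extend_to_tail M E \<xi>"
      unfolding null_events_extend_to_tail_def
    proof (intro ballI impI)
      fix A assume A: "A \<in> sigma_of M E \<xi> {1..}" "prob A = 0"
      then have "prob (space M - A) = 1"
        using prob_compl[OF event] by simp
      then obtain B where B: "B \<in> tail_sigma M E \<xi> {1..}" "prob B = 1" "B \<subseteq> space M - A"
        using sure A unfolding sure_events_shrink_to_tail_def by blast
      then show "\<exists>B\<in>tail_sigma M E \<xi> {1..}. prob B = 0 \<and> A \<subseteq> B"
        using tail_sigma_compl prob_compl[OF tail_event] S.sets_into_space[OF A(1)]
        by (intro bexI[of _ "space M - B"]) auto
    qed
  next
    assume null: "null_events_extend_to_tail M E \<xi>"
    show "sure_events_shrink_to_tail M E \<xi>"
      unfolding sure_events_shrink_to_tail_def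
    proof (intro ballI impI)
      fix A assume A: "A \<in> sigma_of M E \<xi> {1..}" "prob A = 1"
      then have "prob (space M - A) = 0"
        using prob_compl[OF event] by simp
      then obtain B where B: "B \<in> tail_sigma M E \<xi> {1..}" "prob B = 0" "space M - A \<subseteq> B"
        using null A unfolding null_events_extend_to_tail_def by blast
      then show "\<exists>B\<in>tail_sigma M E \<xi> {1..}. prob B = 1 \<and> B \<subseteq> A"
        using tail_sigma_compl prob_compl[OF tail_event]
        by (intro bexI[of _ "space M - B"]) auto
    qed
  qed
qed

text \<open>
  Niceness says that a value of probability zero can be reached from any sample point by altering finitely
  many coordinates, which no tail event notices. A tail event containing such a level set
  \<open>{\<xi> n = e}\<close> must therefore be all of \<open>\<Omega>\<close>.
\<close>

lemma null_events_extend_imp_positive: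
  assumes meas: "\<And>n. n \<ge> 1 \<Longrightarrow> \<xi> n \<in> measurable M (count_space (E n))"
    and nice: "sufficiently_nice M E \<xi>"
    and ext: "null_events_extend_to_tail M E \<xi>"
  shows "all_values_positive M E \<xi>"
proof (rule ccontr)
  have range: "\<xi> n \<in> space M \<rightarrow> E n" if "n \<ge> 1" for n
    using measurable_space[OF meas[OF that]] by auto
  assume "\<not> all_values_positive M E \<xi>"
  then obtain n e where n: "n \<ge> 1" "e \<in> E n"
    and null: "prob {\<omega> \<in> space M. \<xi> n \<omega> = e} = 0"
    unfolding all_values_positive_def by (metis zero_less_measure_iff)
  have "{\<omega> \<in> space M. \<xi> n \<omega> = e} \<in> sigma_of M E \<xi> {1..}"
    using n by (intro level_set_in_sigma_of) auto
  then obtain B where B: "B \<in> tail_sigma M E \<xi> {1..}" "prob B = 0"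
    and sub: "{\<omega> \<in> space M. \<xi> n \<omega> = e} \<subseteq> B"
    using ext null unfolding null_events_extend_to_tail_def by blast
  have "\<not> space M \<subseteq> B"
  proof
    interpret S: sigma_algebra "space M" "sigma_of M E \<xi> {Suc 0..}"
      by (rule sigma_algebra_sigma_of)
    assume "space M \<subseteq> B"
    moreover have "B \<subseteq> space M"
      using B(1) unfolding tail_sigma_iff by (blast dest: S.sets_into_space)
    ultimately show False
      using B(2) prob_space by (metis subset_antisym zero_neq_one)
  qed
  then obtain \<omega> where \<omega>: "\<omega> \<in> space M" "\<omega> \<notin> B"
    by blast
  then have "\<xi> n \<omega> \<noteq> e" "\<xi> n \<omega> \<in> E n"
    using sub range[of n] n by auto
  with nice[unfolded sufficiently_nice_def, rule_format, of n e "\<xi> n \<omega>" \<omega>] n null \<omega>(1)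
  obtain \<omega>' k where \<omega>': "\<omega>' \<in> space M" "\<xi> n \<omega>' = e"
    and "\<forall>l\<ge>k. \<xi> l \<omega> = \<xi> l \<omega>'"
    by auto
  then have eq: "\<xi> l \<omega> = \<xi> l \<omega>'" if "l \<in> {Suc k..}" for l
    using that by simp
  have "B \<in> sigma_of M E \<xi> {Suc k..}"
    using B(1) unfolding tail_sigma_iff by blast
  then have "\<omega> \<in> B \<longleftrightarrow> \<omega>' \<in> B"
    using \<omega>(1) \<omega>'(1) range eq by (intro sigma_of_not_separating[of B M E \<xi> "{Suc k..}"]) simp_all
  moreover have "\<omega>' \<in> B"
    using sub \<omega>' by blast
  ultimately show False
    using \<omega>(2) by simp
qed

end

theorem theorem5:
  fixes M :: "'a measure"
    and E :: "nat \<Rightarrow> 'b set"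
    and \<xi> :: "nat \<Rightarrow> 'a \<Rightarrow> 'b"
  assumes "prob_space M"
    and "\<And>n. n \<ge> 1 \<Longrightarrow> countable (E n)"
    and "prob_space.indep_vars M (\<lambda>n. count_space (E n)) \<xi> {1..}"
  shows "(sure_events_shrink_to_tail M E \<xi> \<longleftrightarrow> null_events_extend_to_tail M E \<xi>)
    \<and> (all_values_positive M E \<xi> \<longrightarrow>
         sure_events_shrink_to_tail M E \<xi> \<and> null_events_extend_to_tail M E \<xi>)
    \<and> (sufficiently_nice M E \<xi> \<longrightarrow>
         (all_values_positive M E \<xi> \<longleftrightarrow> sure_events_shrink_to_tail M E \<xi>)
       \<and> (sure_events_shrink_to_tail M E \<xi> \<longleftrightarrow> null_events_extend_to_tail M E \<xi>)
       \<and> (all_values_positive M E \<xi> \<longleftrightarrow> null_events_extend_to_tail M E \<xi>))"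
proof -
  interpret prob_space M by fact
  have meas: "\<xi> n \<in> measurable M (count_space (E n))" if "n \<ge> 1" for n
    using assms(3) that unfolding indep_vars_def by auto
  have "sure_events_shrink_to_tail M E \<xi> \<longleftrightarrow> null_events_extend_to_tail M E \<xi>"
    using meas by (rule sure_events_shrink_iff_null_events_extend)
  moreover have "null_events_extend_to_tail M E \<xi>" if "all_values_positive M E \<xi>"
    using assms(2,3) that by (rule positive_imp_null_events_extend)
  moreover have "all_values_positive M E \<xi>"
    if "sufficiently_nice M E \<xi>" "null_events_extend_to_tail M E \<xi>"
    using meas that by (rule null_events_extend_imp_positive)
  ultimately show ?thesis
    by blast
qed

end
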